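(* Let $n\ge2$. For $k\ge4$, $t(1,(k-1)n)+1\le t(\mathrm{Wd}(k,n))\le t(1,n)+t(2,k-1)+1$. For $k=3$, $t(1,2n)+1\le t(\mathrm{Wd}(3,n))\le t(1,n)+3$.
   Context: For $k,n\ge2$, the windmill graph $\mathrm{Wd}(k,n)$ is obtained by taking $n$ copies of the complete graph $K_k$ and identifying one vertex from each copy into a single shared vertex; it has $n(k-1)+1$ vertices. For a finite simple graph $G$, a $G$-CFF$(t,|V(G)|)$ is a family of subsets $B_v\subseteq[1,t]=\{1,\dots,t\}$, one for each vertex $v$, such that for every edge $\{a,b\}$: (i) $B_a\not\subseteq B_b$ and $B_b\not\subseteq B_a$, and (ii) for every vertex $w\notin\{a,b\}$, $B_w\not\subseteq B_a\cup B_b$; $t(G)$ is the minimum $t$ for which one exists. $t(1,m)$ is the minimum $t$ such that there exist $m$ subsets of $[1,t]$ none contained in another; equivalently $t(1,m)=\min\{t:\binom{t}{\lfloor t/2\rfloor}\ge m\}$. For $m\ge3$, $t(2,m)$ is the minimum $t$ such that there exist $m$ subsets $B_1,\dots,B_m$ of $[1,t]$ with $B_i\not\subseteq B_j\cup B_l$ for all pairwise distinct $i,j,l$. *)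

theory Defs
  imports Complex_Main
begin

text \<open>A simple graph is a pair of a vertex set and a set of two-element vertex sets.\<close>

type_synonym 'a sgraph = "'a set \<times> 'a set set"

abbreviation verts :: "'a sgraph \<Rightarrow> 'a set" where "verts \<equiv> fst"

abbreviation edges :: "'a sgraph \<Rightarrow> 'a set set" where "edges \<equiv> snd"

definition finite_simple_graph :: "'a sgraph \<Rightarrow> bool" where
  "finite_simple_graph G \<longleftrightarrow> finite (verts G) \<and> (\<forall>e\<in>edges G. e \<subseteq> verts G \<and> card e = 2)"

definition complete_graph :: "'a set \<Rightarrow> 'a sgraph" where
  "complete_graph A = (A, {e. e \<subseteq> A \<and> card e = 2})"

text \<open>The \<open>i\<close>-th copy of \<open>K\<^sub>k\<close> lives on the vertices \<open>(i, 0), \<dots>, (i, k - 1)\<close>; the vertices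
  \<open>(i, 0)\<close> of all copies are identified with the single vertex \<open>(0, 0)\<close>.\<close>

definition wd_copy :: "nat \<Rightarrow> nat \<Rightarrow> (nat \<times> nat) sgraph" where
  "wd_copy k i = complete_graph ({i} \<times> {..<k})"

definition wd_glue :: "nat \<times> nat \<Rightarrow> nat \<times> nat" where
  "wd_glue = (\<lambda>(i, j). if j = 0 then (0, 0) else (i, j))"

definition windmill :: "nat \<Rightarrow> nat \<Rightarrow> (nat \<times> nat) sgraph" where
  "windmill k n =
     (\<Union>i<n. wd_glue ` verts (wd_copy k i),
      \<Union>i<n. (\<lambda>e. wd_glue ` e) ` edges (wd_copy k i))"

text \<open>\<open>G\<close>-CFF\<open>(t, |V(G)|)\<close>; only the values of \<open>B\<close> on the vertices of \<open>G\<close> matter.\<close>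

definition graph_cff :: "'a sgraph \<Rightarrow> nat \<Rightarrow> ('a \<Rightarrow> nat set) \<Rightarrow> bool" where
  "graph_cff G t B \<longleftrightarrow>
     (\<forall>v\<in>verts G. B v \<subseteq> {1..t}) \<and>
     (\<forall>a b. {a, b} \<in> edges G \<longrightarrow>
        \<not> B a \<subseteq> B b \<and> \<not> B b \<subseteq> B a \<and>
        (\<forall>w\<in>verts G. w \<notin> {a, b} \<longrightarrow> \<not> B w \<subseteq> B a \<union> B b))"

definition t_graph :: "'a sgraph \<Rightarrow> nat" where
  "t_graph G = (LEAST t. \<exists>B. graph_cff G t B)"

definition t1 :: "nat \<Rightarrow> nat" where
  "t1 m = (LEAST t. \<exists>B :: nat \<Rightarrow> nat set.
     (\<forall>i<m. B i \<subseteq> {1..t}) \<and>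
     (\<forall>i<m. \<forall>j<m. i \<noteq> j \<longrightarrow> \<not> B i \<subseteq> B j))"

text \<open>Only meaningful for \<open>m \<ge> 3\<close>.\<close>

definition t2 :: "nat \<Rightarrow> nat" where
  "t2 m = (LEAST t. \<exists>B :: nat \<Rightarrow> nat set.
     (\<forall>i<m. B i \<subseteq> {1..t}) \<and>
     (\<forall>i<m. \<forall>j<m. \<forall>l<m. i \<noteq> j \<and> i \<noteq> l \<and> j \<noteq> l \<longrightarrow> \<not> B i \<subseteq> B j \<union> B l))"

text \<open>The minima range over nonempty sets.\<close>

lemma graph_cff_exists:
  assumes "finite_simple_graph G"
  shows "\<exists>t B. graph_cff G t B"
proof -
  have fin: "finite (verts G)"
    and E: "\<And>a b. {a, b} \<in> edges G \<Longrightarrow> a \<in> verts G \<and> b \<in> verts G \<and> a \<noteq> b"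
    using assms unfolding finite_simple_graph_def by (auto simp: card_2_iff)
  obtain f :: "'a \<Rightarrow> nat" and n where f: "f ` verts G = {i. i < n}" "inj_on f (verts G)"
    using finite_imp_inj_to_nat_seg[OF fin] by auto
  have "graph_cff G n (\<lambda>v. {Suc (f v)})"
    unfolding graph_cff_def
  proof (intro conjI ballI allI impI)
    fix v assume "v \<in> verts G"
    then have "f v < n" using f(1) by blast
    then show "{Suc (f v)} \<subseteq> {1..n}" by auto
  qed (use E f(2) in \<open>auto dest!: E simp: inj_on_def\<close>)
  then show ?thesis by blast
qed

lemma t1_exists:
  "\<exists>t. \<exists>B :: nat \<Rightarrow> nat set. (\<forall>i<m. B i \<subseteq> {1..t}) \<and>
     (\<forall>i<m. \<forall>j<m. i \<noteq> j \<longrightarrow> \<not> B i \<subseteq> B j)"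
  by (rule exI[of _ m], rule exI[of _ "\<lambda>i. {Suc i}"]) auto

lemma t2_exists:
  "\<exists>t. \<exists>B :: nat \<Rightarrow> nat set. (\<forall>i<m. B i \<subseteq> {1..t}) \<and>
     (\<forall>i<m. \<forall>j<m. \<forall>l<m. i \<noteq> j \<and> i \<noteq> l \<and> j \<noteq> l \<longrightarrow> \<not> B i \<subseteq> B j \<union> B l)"
  by (rule exI[of _ m], rule exI[of _ "\<lambda>i. {Suc i}"]) auto

lemma finite_simple_graph_windmill: "finite_simple_graph (windmill k n)"
proof -
  have "card (wd_glue ` e) = 2" if "e \<subseteq> {i} \<times> {..<k}" "card e = 2" for e i
  proof -
    have "inj_on wd_glue ({i} \<times> {..<k})"
      by (auto simp: inj_on_def wd_glue_def)
    then show ?thesis using that card_image inj_on_subset by metis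
  qed
  moreover have "finite (verts (windmill k n))"
    by (simp add: windmill_def wd_copy_def complete_graph_def)
  moreover have "e \<subseteq> verts (windmill k n)" if "e \<in> edges (windmill k n)" for e
    using that unfolding windmill_def wd_copy_def complete_graph_def fst_conv snd_conv by blast
  ultimately show ?thesis
    unfolding finite_simple_graph_def
    by (auto simp: windmill_def wd_copy_def complete_graph_def)
qed

lemma verts_windmill:
  assumes "k \<ge> 1" "n \<ge> 1"
  shows "verts (windmill k n) = insert (0, 0) ({..<n} \<times> {1..<k})"
proof (intro equalityI subsetI)
  fix v assume "v \<in> verts (windmill k n)"
  then obtain i j where "i < n" "j < k" "v = wd_glue (i, j)"
    by (auto simp: windmill_def wd_copy_def complete_graph_def)
  then show "v \<in> insert (0, 0) ({..<n} \<times> {1..<k})"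
    by (auto simp: wd_glue_def)
next
  fix v assume v: "v \<in> insert (0, 0) ({..<n} \<times> {1..<k})"
  obtain i j where ij: "v = (i, j)" by (cases v)
  have "i < n" "j < k" "wd_glue (i, j) = v"
    using v assms ij by (auto simp: wd_glue_def)
  then have "v \<in> wd_glue ` ({i} \<times> {..<k})" by (metis imageI SigmaI lessThan_iff singletonI)
  then show "v \<in> verts (windmill k n)"
    using \<open>i < n\<close> by (auto simp: windmill_def wd_copy_def complete_graph_def)
qed

lemma card_verts_windmill:
  assumes "k \<ge> 2" "n \<ge> 2"
  shows "card (verts (windmill k n)) = n * (k - 1) + 1"
  using assms by (subst verts_windmill) auto

end

theory Submission
  imports Defs
begin

text \<open>Lower bound: removing the block of the hub from all other blocks leaves an antichain, since
  every other vertex forms an edge with the hub, and the block of the hub is nonempty, so at least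
  one point is lost. Upper bound: give the hub a private point, and give the \<open>j\<close>-th rim vertex of
  the \<open>i\<close>-th copy the disjoint union of the \<open>i\<close>-th set of an antichain, which separates the copies,
  and the \<open>j\<close>-th set of a 2-cover-free family, which separates the vertices of one copy. For
  \<open>k = 3\<close> two singletons serve as the second family.\<close>

text \<open>Relabelling points and indices by bijections with initial segments of the naturals
  preserves non-inclusion. This frees \<open>t1\<close> from its fixed ground set
  \<open>{1..t}\<close>, so that it applies to the points left after the hub's block is
  removed.\<close>

lemma t1_le_card:
  fixes F :: "'b \<Rightarrow> 'a set"
  assumes "finite V" "finite I"
    and sub: "\<And>i. i \<in> I \<Longrightarrow> F i \<subseteq> V"
    and anti: "\<And>i j. i \<in> I \<Longrightarrow> j \<in> I \<Longrightarrow> i \<noteq> j \<Longrightarrow> \<not> F i \<subseteq> F j"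
  shows "t1 (card I) \<le> card V"
proof -
  obtain g where g: "bij_betw g V {1..card V}"
    using finite_same_card_bij[OF \<open>finite V\<close>, of "{1..card V}"] by auto
  obtain h where h: "bij_betw h {..<card I} I"
    using ex_bij_betw_nat_finite[OF \<open>finite I\<close>] by (auto simp: atLeast0LessThan)
  have hI: "h i \<in> I" if "i < card I" for i
    using h that by (auto simp: bij_betw_def)
  have "\<not> g ` F (h i) \<subseteq> g ` F (h j)" if "i < card I" "j < card I" "i \<noteq> j" for i j
  proof -
    have "h i \<noteq> h j"
      using h that by (auto simp: bij_betw_def inj_on_def)
    then have "\<not> F (h i) \<subseteq> F (h j)"
      using anti hI that by simp
    then obtain x where x: "x \<in> F (h i)" "x \<notin> F (h j)"
      by blast
    moreover have "inj_on g V" "x \<in> V"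
      using g sub[OF hI[OF that(1)]] x by (auto simp: bij_betw_def)
    ultimately have "g x \<notin> g ` F (h j)"
      using inj_on_image_mem_iff sub[OF hI[OF that(2)]] by metis
    then show ?thesis
      using x by blast
  qed
  moreover have "g ` F (h i) \<subseteq> {1..card V}" if "i < card I" for i
    using g sub[OF hI[OF that]] by (auto simp: bij_betw_def)
  ultimately show ?thesis
    unfolding t1_def by (intro Least_le exI[of _ "\<lambda>i. g ` F (h i)"]) blast
qed

lemma hub_edge_windmill:
  assumes "i < n" "1 \<le> j" "j < k"
  shows "{(0, 0), (i, j)} \<in> edges (windmill k n)"
proof -
  have "{(0, 0), (i, j)} = wd_glue ` {(i, 0), (i, j)}"
    using assms by (auto simp: wd_glue_def)
  moreover have "{(i, 0), (i, j)} \<in> edges (wd_copy k i)"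
    using assms by (simp add: wd_copy_def complete_graph_def)
  ultimately show ?thesis
    using assms unfolding windmill_def snd_conv by blast
qed

text \<open>\<open>wd_glue\<close> changes the copy index of the hub's representatives only, so the
  ends of an edge that avoids the hub still share the index of the copy it came from.\<close>

lemma edge_windmillD:
  assumes "{a, b} \<in> edges (windmill k n)"
  shows "a \<noteq> b" "a \<in> verts (windmill k n)" "b \<in> verts (windmill k n)"
    "a = (0, 0) \<or> b = (0, 0) \<or> fst a = fst b"
proof -
  have "{a, b} \<subseteq> verts (windmill k n) \<and> card {a, b} = 2"
    using finite_simple_graph_windmill assms unfolding finite_simple_graph_def by blast
  then show "a \<noteq> b" "a \<in> verts (windmill k n)" "b \<in> verts (windmill k n)"
    by auto
  obtain i e where "e \<subseteq> {i} \<times> {..<k}" "{a, b} = wd_glue ` e"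
    using assms by (auto simp: windmill_def wd_copy_def complete_graph_def)
  then have "a \<in> wd_glue ` ({i} \<times> UNIV)" "b \<in> wd_glue ` ({i} \<times> UNIV)"
    by blast+
  then show "a = (0, 0) \<or> b = (0, 0) \<or> fst a = fst b"
    by (auto simp: wd_glue_def split: if_splits)
qed

lemma t1_less_t_graph_windmill:
  assumes "k \<ge> 2" "n \<ge> 1"
  shows "t1 ((k - 1) * n) + 1 \<le> t_graph (windmill k n)"
proof -
  define t where "t = t_graph (windmill k n)"
  obtain B where B: "graph_cff (windmill k n) t B"
    using LeastI_ex[OF graph_cff_exists[OF finite_simple_graph_windmill]]
    unfolding t_def t_graph_def by blast
  define I where "I = {..<n} \<times> {1..<k}"
  have V: "verts (windmill k n) = insert (0, 0) I"
    using assms by (simp add: verts_windmill I_def)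
  have E: "{(0, 0), v} \<in> edges (windmill k n)" if "v \<in> I" for v
    using that by (auto simp: I_def intro!: hub_edge_windmill)
  have sub: "B v \<subseteq> {1..t}" if "v \<in> insert (0, 0) I" for v
    using B that V unfolding graph_cff_def by blast
  \<comment> \<open>Any rim vertex will do: an empty hub block would lie inside the block of its
    neighbour.\<close>
  have "(0, 1) \<in> I"
    using assms by (auto simp: I_def)
  then have "B (0, 0) \<noteq> {}"
    using B E unfolding graph_cff_def by blast
  then have "{1..t} - B (0, 0) \<subset> {1..t}"
    using sub[of "(0, 0)"] by auto
  then have less: "card ({1..t} - B (0, 0)) < t"
    using psubset_card_mono[of "{1..t}"] by simp
  have "t1 (card I) \<le> card ({1..t} - B (0, 0))"
  proof (rule t1_le_card[where F = "\<lambda>v. B v - B (0, 0)"])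
    fix v w assume vw: "v \<in> I" "w \<in> I" "v \<noteq> w"
    then have "v \<notin> {(0, 0), w}"
      by (auto simp: I_def)
    \<comment> \<open>Condition (ii) for the edge from the hub to \<open>w\<close>, with
      \<open>v\<close> as the third vertex.\<close>
    then have "\<not> B v \<subseteq> B (0, 0) \<union> B w"
      using B E[OF vw(2)] vw V unfolding graph_cff_def by blast
    then show "\<not> B v - B (0, 0) \<subseteq> B w - B (0, 0)"
      by blast
  qed (use sub in \<open>auto simp: I_def\<close>)
  moreover have "card I = (k - 1) * n"
    by (simp add: I_def)
  ultimately show ?thesis
    using less unfolding t_def by simp
qed

text \<open>The antichain condition on \<open>C\<close> is kept apart from the 2-cover-free
  condition because the latter is vacuous on two indices, which is the case
  \<open>k = 3\<close>.\<close>

lemma t_graph_windmill_le: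
  fixes C :: "nat \<Rightarrow> nat set"
  assumes "k \<ge> 1" "n \<ge> 2"
    and C: "\<And>j. j < k - 1 \<Longrightarrow> C j \<subseteq> {1..s}"
    and C1: "\<And>i j. i < k - 1 \<Longrightarrow> j < k - 1 \<Longrightarrow> i \<noteq> j \<Longrightarrow> \<not> C i \<subseteq> C j"
    and C2: "\<And>i j l. i < k - 1 \<Longrightarrow> j < k - 1 \<Longrightarrow> l < k - 1 \<Longrightarrow>
      i \<noteq> j \<Longrightarrow> i \<noteq> l \<Longrightarrow> j \<noteq> l \<Longrightarrow> \<not> C i \<subseteq> C j \<union> C l"
  shows "t_graph (windmill k n) \<le> t1 n + s + 1"
proof -
  define t where "t = t1 n"
  obtain A :: "nat \<Rightarrow> nat set" where A: "\<And>i. i < n \<Longrightarrow> A i \<subseteq> {1..t}"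
    and A1: "\<And>i j. i < n \<Longrightarrow> j < n \<Longrightarrow> i \<noteq> j \<Longrightarrow> \<not> A i \<subseteq> A j"
    using LeastI_ex[OF t1_exists[of n]] unfolding t_def t1_def[symmetric] by metis
  \<comment> \<open>The sets \<open>A i\<close> occupy \<open>{1..t}\<close> and the shifted sets
    \<open>C j\<close> occupy \<open>{t + 1..t + s}\<close>, so this is the first free
    point.\<close>
  define H where "H = {t + s + 1}"
  \<comment> \<open>Rim positions start at 1, the indices of \<open>C\<close> at 0; hence
    \<open>snd v - 1\<close>, which loses nothing on \<open>I\<close>.\<close>
  define R where "R = (\<lambda>v::nat \<times> nat. A (fst v) \<union> (+) t ` C (snd v - 1))"
  define B where "B = (\<lambda>v. if v = (0, 0) then H else R v)"
  define I where "I = {..<n} \<times> {1..<k}"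
  have V: "verts (windmill k n) = insert (0, 0) I"
    using assms by (simp add: verts_windmill I_def)
  have RB: "B v = R v" if "v \<in> I" for v
    using that by (auto simp: B_def I_def)
  have idx: "fst v < n" "snd v - 1 < k - 1" if "v \<in> I" for v
    using that by (auto simp: I_def)
  have sub: "R v \<subseteq> {1..t + s}" if "v \<in> I" for v
    using A[OF idx(1)[OF that]] C[OF idx(2)[OF that]] by (fastforce simp: R_def)
  have H: "\<not> H \<subseteq> R v \<union> R w" if "v \<in> I" "w \<in> I" for v w
    using sub[OF that(1)] sub[OF that(2)] by (auto simp: H_def)
  have disj: "A i \<inter> (+) t ` C j = {}" if "i < n" "j < k - 1" for i j
    using A[OF that(1)] C[OF that(2)] by fastforce
  have snd_neq: "snd v - 1 \<noteq> snd w - 1" if "v \<in> I" "w \<in> I" "v \<noteq> w" "fst v = fst w" for v w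
    using that by (auto simp: I_def)
  \<comment> \<open>Since \<open>a\<close> and \<open>b\<close> carry the same set of the antichain,
    one point of \<open>A (fst w)\<close> outside it escapes both blocks.\<close>
  have other_copy: "\<not> R w \<subseteq> R a \<union> R b"
    if "w \<in> I" "a \<in> I" "b \<in> I" "fst a = fst b" "fst w \<noteq> fst a" for w a b
  proof -
    have "\<not> A (fst w) \<subseteq> A (fst a)"
      using A1[OF idx(1)[OF \<open>w \<in> I\<close>] idx(1)[OF \<open>a \<in> I\<close>]] that by simp
    then obtain x where x: "x \<in> A (fst w)" "x \<notin> A (fst a)"
      by blast
    have "x \<notin> (+) t ` C (snd v - 1)" if "v \<in> I" for v
      using disj[OF idx(1)[OF \<open>w \<in> I\<close>] idx(2)[OF that]] x by blast
    then have "x \<in> R w" "x \<notin> R a" "x \<notin> R b"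
      using x that by (simp_all add: R_def)
    then show ?thesis
      by blast
  qed
  have same_copy: "\<not> R w \<subseteq> R a \<union> R b"
    if "w \<in> I" "a \<in> I" "b \<in> I" "fst a = fst b" "fst w = fst a" "w \<noteq> a" "w \<noteq> b" for w a b
  proof -
    let ?c = "\<lambda>v::nat \<times> nat. C (snd v - 1)"
    have "\<not> ?c w \<subseteq> ?c a \<union> ?c b"
    proof (cases "a = b")
      case True
      then show ?thesis
        using C1[OF idx(2)[OF \<open>w \<in> I\<close>] idx(2)[OF \<open>a \<in> I\<close>]] snd_neq that by simp
    next
      case False
      then show ?thesis
        using that by (intro C2 idx snd_neq) simp_all
    qed
    then obtain x where x: "x \<in> ?c w" "x \<notin> ?c a \<union> ?c b"
      by blast
    then have "t + x \<in> R w" "t + x \<notin> (+) t ` ?c a" "t + x \<notin> (+) t ` ?c b"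
      by (auto simp: R_def)
    moreover have "t + x \<notin> A (fst a)"
      using disj[OF idx(1)[OF \<open>a \<in> I\<close>] idx(2)[OF \<open>w \<in> I\<close>]] x by blast
    ultimately have "t + x \<notin> R a" "t + x \<notin> R b"
      using \<open>fst a = fst b\<close> by (simp_all add: R_def)
    then show ?thesis
      using \<open>t + x \<in> R w\<close> by blast
  qed
  have rim: "\<not> R w \<subseteq> R a \<union> R b"
    if "w \<in> I" "a \<in> I" "b \<in> I" "fst a = fst b" "w \<noteq> a" "w \<noteq> b" for w a b
    using other_copy same_copy that by metis
  \<comment> \<open>The hub's point lies in no rim block, so adding \<open>H\<close> on the right
    does not help to cover \<open>R w\<close>.\<close>
  have rim_hub: "\<not> R w \<subseteq> R a \<union> H" if "w \<in> I" "a \<in> I" "w \<noteq> a" for w a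
    using rim[of w a a] that sub[OF that(1)] by (auto simp: H_def)
  have nonempty: "\<not> R w \<subseteq> H" if "w \<in> I" for w
  proof -
    \<comment> \<open>With a second copy present, \<open>A (fst w)\<close> is not contained in
      another set and so has a point, which is at most \<open>t\<close> and thus outside
      \<open>H\<close>.\<close>
    obtain i where "i < n" "i \<noteq> fst w"
      using \<open>n \<ge> 2\<close> that[of 0] that[of 1] by fastforce
    then have "A (fst w) \<noteq> {}"
      using A1 idx(1)[OF that] by blast
    then show ?thesis
      using sub[OF that] unfolding H_def R_def by fastforce
  qed
  \<comment> \<open>One direction of condition (i) suffices, as \<open>a\<close> and
    \<open>b\<close> can be swapped in \<open>{a, b}\<close>.\<close>
  have edge: "\<not> B a \<subseteq> B b \<and> (\<forall>w\<in>verts (windmill k n). w \<notin> {a, b} \<longrightarrow> \<not> B w \<subseteq> B a \<union> B b)"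
    if "{a, b} \<in> edges (windmill k n)" for a b
  proof -
    have ab: "a \<noteq> b" "a \<in> insert (0, 0) I" "b \<in> insert (0, 0) I"
      "a = (0, 0) \<or> b = (0, 0) \<or> fst a = fst b"
      using edge_windmillD[OF that] V by auto
    have hub: "B (0, 0) = H"
      by (simp add: B_def)
    consider "a = (0, 0)" "b \<in> I" | "a \<in> I" "b = (0, 0)" | "a \<in> I" "b \<in> I" "fst a = fst b"
      using ab by (auto simp: I_def)
    then show ?thesis
    proof cases
      case 1
      then show ?thesis
        using V H[of b b] rim_hub[of _ b] by (auto simp: hub RB Un_commute)
    next
      case 2
      then show ?thesis
        using V nonempty rim_hub[of _ a] by (auto simp: hub RB Un_commute)
    next
      case 3
      then show ?thesis
        using V ab(1) H[of a b] rim[of a b b] rim[of _ a b] by (auto simp: hub RB)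
    qed
  qed
  have "graph_cff (windmill k n) (t + s + 1) B"
    unfolding graph_cff_def
  proof (intro conjI ballI allI impI)
    fix v assume "v \<in> verts (windmill k n)"
    then consider "v = (0, 0)" | "v \<in> I"
      using V by blast
    then show "B v \<subseteq> {1..t + s + 1}"
    proof cases
      case 1
      then show ?thesis
        by (simp add: B_def H_def)
    next
      case 2
      have "{1..t + s} \<subseteq> {1..t + s + 1}"
        by simp
      then show ?thesis
        using sub[OF 2] RB[OF 2] by blast
    qed
  next
    fix a b assume "{a, b} \<in> edges (windmill k n)"
    then show "\<not> B b \<subseteq> B a"
      using edge[of b a] by (simp add: insert_commute)
  qed (use edge in blast)+
  then show ?thesis
    unfolding t_graph_def t_def by (intro Least_le exI)
qed

text \<open>For \<open>k \<ge> 4\<close> there are at least three indices, so any two have a third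
  index \<open>l\<close> beside them, and \<open>C i\<close> not being covered by
  \<open>C j \<union> C l\<close> gives the antichain condition.\<close>

lemma t_graph_windmill_le_t2:
  assumes "k \<ge> 4" "n \<ge> 2"
  shows "t_graph (windmill k n) \<le> t1 n + t2 (k - 1) + 1"
proof -
  obtain C :: "nat \<Rightarrow> nat set" where C: "\<And>j. j < k - 1 \<Longrightarrow> C j \<subseteq> {1..t2 (k - 1)}"
    and C2: "\<And>i j l. i < k - 1 \<Longrightarrow> j < k - 1 \<Longrightarrow> l < k - 1 \<Longrightarrow>
      i \<noteq> j \<Longrightarrow> i \<noteq> l \<Longrightarrow> j \<noteq> l \<Longrightarrow> \<not> C i \<subseteq> C j \<union> C l"
    using LeastI_ex[OF t2_exists[of "k - 1"]] unfolding t2_def[symmetric] by metis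
  have "\<not> C i \<subseteq> C j" if ij: "i < k - 1" "j < k - 1" "i \<noteq> j" for i j
  proof -
    have "\<not> {..<k - 1} \<subseteq> {i, j}"
      using card_mono[of "{i, j}" "{..<k - 1}"] \<open>k \<ge> 4\<close> ij by auto
    then obtain l where "l < k - 1" "l \<noteq> i" "l \<noteq> j"
      by blast
    then show ?thesis
      using C2[of i j l] ij by blast
  qed
  then show ?thesis
    using assms by (intro t_graph_windmill_le[OF _ _ C _ C2]) auto
qed

theorem theorem7p4:
  fixes n :: nat
  assumes "n \<ge> 2"
  shows "(\<forall>k\<ge>4. t1 ((k - 1) * n) + 1 \<le> t_graph (windmill k n) \<and>
                 t_graph (windmill k n) \<le> t1 n + t2 (k - 1) + 1) \<and>
         (t1 (2 * n) + 1 \<le> t_graph (windmill 3 n) \<and>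
          t_graph (windmill 3 n) \<le> t1 n + 3)"
proof -
  have "t1 ((k - 1) * n) + 1 \<le> t_graph (windmill k n)" if "k \<ge> 2" for k
    using t1_less_t_graph_windmill that assms by simp
  moreover from this[of 3] have "t1 (2 * n) + 1 \<le> t_graph (windmill 3 n)"
    by simp
  \<comment> \<open>The second family is \<open>{1}\<close>, \<open>{2}\<close>, so
    \<open>s = 2\<close>.\<close>
  moreover have "t_graph (windmill 3 n) \<le> t1 n + 2 + 1"
    using assms by (intro t_graph_windmill_le[where C = "\<lambda>j. {Suc j}"]) auto
  ultimately show ?thesis
    using t_graph_windmill_le_t2 assms by simp
qed

end
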